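(* Let $n\ge 1$, let $c=(c_1\le c_2\le\cdots\le c_k)$ be a nondecreasing sequence of positive integers with $c_1+\cdots+c_k=n$, and let $(b_1,\ldots,b_n)$ be a sequence of half-integers (elements of $\tfrac12\mathbb{Z}$) with $b_1+\cdots+b_n=0$. Then $$\mathrm{mult}_{(c_1,\ldots,c_k)}(b_1,\ldots,b_n)=\sum_{J}\mathrm{mult}_{(c_1-1,c_2,\ldots,c_k)}\Big(b_2,\ldots,b_{c_1},\,b_{c_1+1}+\mathbf{1}_J(c_1+1)-\tfrac12,\ldots,b_n+\mathbf{1}_J(n)-\tfrac12\Big),$$ where $J$ runs over the set $\mathcal{P}_{b_1+\frac{n-c_1}{2}}(\{c_1+1,\ldots,n\})$.
   Context: Let $\mathfrak{g}=\mathfrak{sl}(n,\mathbb{C})$, $\mathfrak{t}\subset\mathfrak g$ the Cartan subalgebra of diagonal matrices, $\epsilon_i\in\mathfrak{t}^*$ the functional $\mathrm{diag}(t_1,\ldots,t_n)\mapsto t_i$, and $\Phi^+=\{\epsilon_i-\epsilon_j: 1\le i<j\le n\}$. For the sequence $c=(c_1,\ldots,c_k)$, let $\mathfrak{h}=\mathfrak{h}(c)$ be the Levi subalgebra of block-diagonal matrices in $\mathfrak g$ with diagonal blocks of sizes $c_1,\ldots,c_k$ (in this order), and let $\mathfrak{q}$ be its orthogonal complement for the Killing form. Let $\Phi^+(\mathfrak{q})\subset\Phi^+$ be the set of positive roots of $\mathfrak q$, i.e. the $\epsilon_i-\epsilon_j$ with $i<j$ such that $i$ and $j$ lie in different blocks,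 and $\mathfrak{u}^+=\bigoplus_{\alpha\in\Phi^+(\mathfrak q)}\mathfrak g_\alpha$. The spin module of $\mathfrak{h}$ is $\mathbf{S}=\bigwedge\mathfrak{u}^+$ with $\mathfrak{h}$ acting through $\mathfrak{h}\xrightarrow{\mathrm{ad}}\mathfrak{so}(\mathfrak{q})\subset\mathbf{C}(\mathfrak{q})\to\mathrm{End}(\mathbf{S})$ (Clifford multiplication). Its $\mathfrak t$-weights are $\mu(A)=\frac12\big(\sum_{\alpha\in\Phi^+(\mathfrak q)\setminus A}\alpha-\sum_{\alpha\in A}\alpha\big)$ for $A\subset\Phi^+(\mathfrak{q})$, and for $\mu\in\mathfrak t^*$ the multiplicity is $\mathrm{mult}_{\mathbf{S}}(\mu)=\#\{A\subset\Phi^+(\mathfrak q):\mu(A)=\mu\}$ (so it is $0$ if $\mu$ is not a weight). Notation: $\mathrm{mult}_{(c_1,\ldots,c_k)}(b_1,\ldots,b_n):=\mathrm{mult}_{\mathbf S}\big(\sum_{i=1}^n b_i\epsilon_i\big)$ for $\mathbf{S}$ the spin module of $\mathfrak{h}(c)$. For a set $X$, $\mathcal{P}_r(X)$ is the set of subsets of $X$ with $r$ elements (empty if $r$ is not an integer between $0$ and $\#X$); for $J\subset X$, $\mathbf{1}_J(x)=1$ if $x\in J$ and $0$ if $x\notin J$. Conventions: on the right-hand side the multiplicity is computed in $\mathfrak{sl}(n-1,\mathbb C)$; if $c_1-1=0$, the zero part is discarded; in the degenerate case $n-1=0$ the multiplicity of the empty sequence is $1$. If $c_1=1$ the list $b_2,\ldots,b_{c_1}$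 is empty. *)

theory Defs
  imports
    "HOL-Library.Function_Algebras"
    "HOL-Library.Indicator_Function"
    "Jordan_Normal_Form.Matrix"
begin

text \<open>
  Throughout, \<open>c = [c\<^sub>1, \<dots>, c\<^sub>k]\<close> is the list of block sizes, \<open>n = sum_list c\<close>, and matrices are
  indexed by \<open>{0..<n}\<close>, as usual for \<open>mat\<close>.  A functional on the Cartan subalgebra is represented by
  a function on all matrices, of which only the restriction to the Cartan subalgebra is ever used.
\<close>

definition cartan :: "nat \<Rightarrow> complex mat set" where
  "cartan n = {H \<in> carrier_mat n n. diagonal_mat H \<and> (\<Sum>i<n. H $$ (i, i)) = 0}"

definition eps :: "nat \<Rightarrow> complex mat \<Rightarrow> complex" where
  "eps i H = H $$ (i, i)"

definition root_form :: "nat \<times> nat \<Rightarrow> complex mat \<Rightarrow> complex" where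
  "root_form \<alpha> H = eps (fst \<alpha>) H - eps (snd \<alpha>) H"

fun block :: "nat list \<Rightarrow> nat \<Rightarrow> nat" where
  "block [] i = 0"
| "block (m # c) i = (if i < m then 0 else Suc (block c (i - m)))"

text \<open>
  The orthogonal complement \<open>\<qq>\<close> of the block-diagonal subalgebra is spanned by the matrix units
  \<open>E\<^sub>i\<^sub>j\<close> with \<open>(i, j) \<in> q_pairs c\<close>; the pair \<open>(i, j)\<close> stands for the root \<open>\<epsilon>\<^sub>i - \<epsilon>\<^sub>j\<close>.
\<close>

definition q_pairs :: "nat list \<Rightarrow> (nat \<times> nat) set" where
  "q_pairs c = {(i, j). i < sum_list c \<and> j < sum_list c \<and> block c i \<noteq> block c j}"

definition q_pos_roots :: "nat list \<Rightarrow> (nat \<times> nat) set" where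
  "q_pos_roots c = {(i, j) \<in> q_pairs c. i < j}"

definition unit_matrix :: "nat \<Rightarrow> nat \<times> nat \<Rightarrow> complex mat" where
  "unit_matrix n \<alpha> = mat n n (\<lambda>\<beta>. if \<beta> = \<alpha> then 1 else 0)"

text \<open>The Killing form of \<open>\<ss>\<ll>(n, \<complex>)\<close> is \<open>2n tr (XY)\<close>.\<close>

definition killing :: "nat \<Rightarrow> complex mat \<Rightarrow> complex mat \<Rightarrow> complex" where
  "killing n X Y = 2 * of_nat n * (\<Sum>i<n. (X * Y) $$ (i, i))"

text \<open>
  The exterior algebra of \<open>\<uu>\<^sup>+\<close> is written in its standard basis: a spinor \<open>v\<close> stands for the sum
  of all \<open>v A \<cdot> e\<^sub>A\<close>, where \<open>e\<^sub>A\<close> is the wedge product of the \<open>E\<^sub>\<alpha>\<close>, \<open>\<alpha> \<in> A\<close>, in lexicographic order.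
\<close>

type_synonym spinor = "(nat \<times> nat) set \<Rightarrow> complex"

definition spin_module :: "nat list \<Rightarrow> spinor set" where
  "spin_module c = {v. \<forall>A. v A \<noteq> 0 \<longrightarrow> A \<subseteq> q_pos_roots c}"

definition wedge_sign :: "nat \<times> nat \<Rightarrow> (nat \<times> nat) set \<Rightarrow> complex" where
  "wedge_sign \<alpha> A =
    (- 1) ^ card {\<beta> \<in> A. fst \<beta> < fst \<alpha> \<or> fst \<beta> = fst \<alpha> \<and> snd \<beta> < snd \<alpha>}"

definition wedge :: "nat \<times> nat \<Rightarrow> spinor \<Rightarrow> spinor" where
  "wedge \<alpha> v A = (if \<alpha> \<in> A then wedge_sign \<alpha> A * v (A - {\<alpha>}) else 0)"

definition contract :: "nat \<times> nat \<Rightarrow> spinor \<Rightarrow> spinor" where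
  "contract \<alpha> v A = (if \<alpha> \<in> A then 0 else wedge_sign \<alpha> A * v (insert \<alpha> A))"

text \<open>
  Clifford multiplication by \<open>X \<in> \<qq>\<close>, for the Clifford algebra with relations
  \<open>XY + YX = 2 B(X, Y)\<close>, where \<open>B\<close> is the Killing form: the component of \<open>X\<close> in \<open>\<uu>\<^sup>+\<close> acts by
  exterior multiplication, its component \<open>X\<^sup>-\<close> in \<open>\<uu>\<^sup>-\<close> by contraction with \<open>2 B(X\<^sup>-, \<cdot>)\<close>.
\<close>

definition clifford :: "nat list \<Rightarrow> complex mat \<Rightarrow> spinor \<Rightarrow> spinor" where
  "clifford c X v = (\<lambda>A. \<Sum>(i, j)\<in>q_pos_roots c.
     X $$ (i, j) * wedge (i, j) v A
     + 2 * X $$ (j, i) * killing (sum_list c) (unit_matrix (sum_list c) (j, i))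
         (unit_matrix (sum_list c) (i, j)) * contract (i, j) v A)"

text \<open>
  The embedding \<open>\<ss>\<oo>(\<qq>) \<subseteq> C(\<qq>)\<close> sends \<open>T\<close> to the sum of all \<open>1/4 T(e\<^sub>a) e\<^sup>a\<close>, where \<open>(e\<^sub>a)\<close> is a basis of \<open>\<qq>\<close>
  and \<open>(e\<^sup>a)\<close> its dual basis with respect to \<open>B\<close>; it is characterised by
  \<open>[T, Y] = T(Y)\<close> in \<open>C(\<qq>)\<close> for all \<open>Y \<in> \<qq>\<close>.  Here \<open>e\<^sub>a = E\<^sub>i\<^sub>j\<close> and \<open>e\<^sup>a = E\<^sub>j\<^sub>i / B(E\<^sub>i\<^sub>j, E\<^sub>j\<^sub>i)\<close>.
\<close>

definition spin_action :: "nat list \<Rightarrow> complex mat \<Rightarrow> spinor \<Rightarrow> spinor" where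
  "spin_action c X v = (\<lambda>A. 1 / 4 * (\<Sum>(i, j)\<in>q_pairs c.
     (let n = sum_list c; E = unit_matrix n (i, j); F = unit_matrix n (j, i)
      in clifford c (X * E - E * X) (clifford c F v) A / killing n E F)))"

global_interpretation spinors: vector_space "\<lambda>(z::complex) (v::spinor) A. z * v A"
  by unfold_locales (auto simp: fun_eq_iff algebra_simps)

definition weight_space :: "nat list \<Rightarrow> (complex mat \<Rightarrow> complex) \<Rightarrow> spinor set" where
  "weight_space c \<mu> = {v \<in> spin_module c.
     \<forall>H\<in>cartan (sum_list c). spin_action c H v = (\<lambda>A. \<mu> H * v A)}"

definition mult_S :: "nat list \<Rightarrow> (complex mat \<Rightarrow> complex) \<Rightarrow> nat" where
  "mult_S c \<mu> = spinors.dim (weight_space c \<mu>)"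

definition spin_mult :: "nat list \<Rightarrow> real list \<Rightarrow> nat" where
  "spin_mult c bs = mult_S c (\<lambda>H. \<Sum>i<length bs. complex_of_real (bs ! i) * eps i H)"

definition subsets_of_size :: "real \<Rightarrow> 'a set \<Rightarrow> 'a set set" where
  "subsets_of_size r X = {J. J \<subseteq> X \<and> finite J \<and> real (card J) = r}"


text \<open>
  Multiplicities count subsets of \<open>\<Phi>\<^sup>+(\<qq>)\<close>.  The weight of \<open>e\<^sub>A\<close> is \<open>spin_weight c (\<Phi>\<^sup>+(\<qq>) - A)\<close>.
\<close>

definition spin_weight :: "nat list \<Rightarrow> (nat \<times> nat) set \<Rightarrow> complex mat \<Rightarrow> complex" where
  "spin_weight c A H =
    1 / 2 * ((\<Sum>\<alpha>\<in>q_pos_roots c - A. root_form \<alpha> H) - (\<Sum>\<alpha>\<in>A. root_form \<alpha> H))"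

lemma finite_q_pairs: "finite (q_pairs c)"
  by (rule finite_subset[of _ "{..<sum_list c} \<times> {..<sum_list c}"]) (auto simp: q_pairs_def)

lemma finite_q_pos_roots: "finite (q_pos_roots c)"
  by (rule finite_subset[OF _ finite_q_pairs[of c]]) (auto simp: q_pos_roots_def)

lemma q_pos_rootsD:
  "(i, j) \<in> q_pos_roots c \<Longrightarrow> i < j \<and> i < sum_list c \<and> j < sum_list c \<and> (j, i) \<notin> q_pos_roots c"
  by (auto simp: q_pos_roots_def q_pairs_def)

lemma sum_q_pairs:
  "(\<Sum>(i, j)\<in>q_pairs c. f i j) = (\<Sum>(i, j)\<in>q_pos_roots c. f i j + f j i :: complex)"
proof -
  have eq: "q_pairs c = q_pos_roots c \<union> prod.swap ` q_pos_roots c"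
  proof (rule Set.set_eqI)
    fix x :: "nat \<times> nat"
    obtain i j where x: "x = (i, j)" by (cases x)
    have "i \<noteq> j" if "(i, j) \<in> q_pairs c" using that by (auto simp: q_pairs_def)
    moreover have "(i, j) \<in> q_pairs c \<longleftrightarrow> (j, i) \<in> q_pairs c" by (auto simp: q_pairs_def)
    moreover have "(i, j) \<in> prod.swap ` q_pos_roots c \<longleftrightarrow> (j, i) \<in> q_pos_roots c" by force
    ultimately show "x \<in> q_pairs c \<longleftrightarrow> x \<in> q_pos_roots c \<union> prod.swap ` q_pos_roots c"
      unfolding x q_pos_roots_def by auto
  qed
  have disj: "q_pos_roots c \<inter> prod.swap ` q_pos_roots c = {}"
    by (auto simp: q_pos_roots_def)
  have "(\<Sum>(i, j)\<in>prod.swap ` q_pos_roots c. f i j) = (\<Sum>(i, j)\<in>q_pos_roots c. f j i)"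
    by (subst sum.reindex) (auto simp: case_prod_unfold)
  thus ?thesis
    unfolding eq
    by (subst sum.union_disjoint)
      (auto simp: disj finite_q_pos_roots sum.distrib case_prod_unfold)
qed

lemma killing_unit:
  assumes "i < n" "j < n"
  shows "killing n (unit_matrix n (i, j)) (unit_matrix n (j, i)) = 2 * of_nat n"
proof -
  have "(unit_matrix n (i, j) * unit_matrix n (j, i)) $$ (k, k) = (if k = i then 1 else 0)"
    if "k < n" for k
    using that assms
    by (auto simp: unit_matrix_def scalar_prod_def if_distrib if_distribR sum.delta cong: if_cong)
  hence "(\<Sum>k<n. (unit_matrix n (i, j) * unit_matrix n (j, i)) $$ (k, k))
    = (\<Sum>k<n. if k = i then 1 else 0)" by (intro sum.cong) auto
  also have "\<dots> = 1" using assms by (simp add: sum.delta)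
  finally show ?thesis unfolding killing_def by simp
qed

lemma clifford_pos:
  assumes "(i, j) \<in> q_pos_roots c"
    and X: "\<And>k l. k < sum_list c \<Longrightarrow> l < sum_list c \<Longrightarrow> X $$ (k, l) = (if (k, l) = (i, j) then z else 0)"
  shows "clifford c X v A = z * wedge (i, j) v A"
proof -
  have "clifford c X v A
    = (\<Sum>\<alpha>\<in>q_pos_roots c. if \<alpha> = (i, j) then z * wedge (i, j) v A else 0)"
    unfolding clifford_def
  proof (intro sum.cong refl)
    fix \<alpha> assume "\<alpha> \<in> q_pos_roots c"
    moreover obtain k l where "\<alpha> = (k, l)" by (cases \<alpha>)
    ultimately show "(case \<alpha> of (k, l) \<Rightarrow> X $$ (k, l) * wedge (k, l) v A
       + 2 * X $$ (l, k) * killing (sum_list c) (unit_matrix (sum_list c) (l, k))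
         (unit_matrix (sum_list c) (k, l)) * contract (k, l) v A)
      = (if \<alpha> = (i, j) then z * wedge (i, j) v A else 0)"
      using q_pos_rootsD[OF assms(1)] q_pos_rootsD[of k l c] X[of k l] X[of l k] by auto
  qed
  thus ?thesis using assms(1) by (simp add: finite_q_pos_roots)
qed

lemma clifford_neg:
  assumes "(i, j) \<in> q_pos_roots c"
    and X: "\<And>k l. k < sum_list c \<Longrightarrow> l < sum_list c \<Longrightarrow> X $$ (k, l) = (if (k, l) = (j, i) then z else 0)"
  shows "clifford c X v A = 4 * of_nat (sum_list c) * z * contract (i, j) v A"
proof -
  have "clifford c X v A
    = (\<Sum>\<alpha>\<in>q_pos_roots c. if \<alpha> = (i, j) then 4 * of_nat (sum_list c) * z * contract (i, j) v A else 0)"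
    unfolding clifford_def
  proof (intro sum.cong refl)
    fix \<alpha> assume "\<alpha> \<in> q_pos_roots c"
    moreover obtain k l where "\<alpha> = (k, l)" by (cases \<alpha>)
    ultimately show "(case \<alpha> of (k, l) \<Rightarrow> X $$ (k, l) * wedge (k, l) v A
       + 2 * X $$ (l, k) * killing (sum_list c) (unit_matrix (sum_list c) (l, k))
         (unit_matrix (sum_list c) (k, l)) * contract (k, l) v A)
      = (if \<alpha> = (i, j) then 4 * of_nat (sum_list c) * z * contract (i, j) v A else 0)"
      using q_pos_rootsD[OF assms(1)] q_pos_rootsD[of k l c] X[of k l] X[of l k]
      by (auto simp: killing_unit)
  qed
  thus ?thesis using assms(1) by (simp add: finite_q_pos_roots)
qed

lemma commutator_unit:
  assumes H: "H \<in> cartan n" and ij: "i < n" "j < n" and kl: "k < n" "l < n"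
  shows "(H * unit_matrix n (i, j) - unit_matrix n (i, j) * H) $$ (k, l)
    = (if (k, l) = (i, j) then root_form (i, j) H else 0)"
proof -
  have d: "dim_row H = n" "dim_col H = n" using H by (auto simp: cartan_def)
  have off: "H $$ (a, b) = 0" if "a < n" "b < n" "a \<noteq> b" for a b
    using H that by (auto simp: cartan_def diagonal_mat_def)
  have 1: "(H * unit_matrix n (i, j)) $$ (k, l) = (if l = j then H $$ (k, i) else 0)"
    using d ij kl
    by (auto simp: unit_matrix_def scalar_prod_def if_distrib if_distribR sum.delta cong: if_cong)
  have 2: "(unit_matrix n (i, j) * H) $$ (k, l) = (if k = i then H $$ (j, l) else 0)"
    using d ij kl
    by (auto simp: unit_matrix_def scalar_prod_def if_distrib if_distribR sum.delta cong: if_cong)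
  have "(H * unit_matrix n (i, j) - unit_matrix n (i, j) * H) $$ (k, l)
    = (H * unit_matrix n (i, j)) $$ (k, l) - (unit_matrix n (i, j) * H) $$ (k, l)"
    using d kl by (intro index_minus_mat) (auto simp: unit_matrix_def)
  thus ?thesis unfolding 1 2 using off ij kl by (auto simp: root_form_def eps_def)
qed

lemma wedge_sign_Diff: "wedge_sign \<alpha> (A - {\<alpha>}) = wedge_sign \<alpha> A"
  unfolding wedge_sign_def by (rule arg_cong[where f = "\<lambda>B. (- 1) ^ card B"]) auto

lemma wedge_sign_insert: "wedge_sign \<alpha> (insert \<alpha> A) = wedge_sign \<alpha> A"
  unfolding wedge_sign_def by (rule arg_cong[where f = "\<lambda>B. (- 1) ^ card B"]) auto

lemma wedge_sign_square: "wedge_sign \<alpha> A * (wedge_sign \<alpha> A * z) = z"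
  by (simp add: wedge_sign_def flip: mult.assoc power_mult_distrib)

lemma wedge_contract: "wedge \<alpha> (\<lambda>A. a * contract \<alpha> v A) A = (if \<alpha> \<in> A then a * v A else 0)"
  by (auto simp: wedge_def contract_def wedge_sign_Diff insert_absorb mult.left_commute wedge_sign_square)

lemma contract_wedge: "contract \<alpha> (\<lambda>A. a * wedge \<alpha> v A) A = (if \<alpha> \<in> A then 0 else a * v A)"
  by (auto simp: wedge_def contract_def wedge_sign_insert mult.left_commute wedge_sign_square)

lemma spin_action_cartan:
  assumes H: "H \<in> cartan (sum_list c)" and A: "A \<subseteq> q_pos_roots c"
  shows "spin_action c H v A = spin_weight c (q_pos_roots c - A) H * v A"
proof -
  define n where "n = sum_list c"
  define f where "f i j = (let E = unit_matrix n (i, j); F = unit_matrix n (j, i)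
      in clifford c (H * E - E * H) (clifford c F v) A / killing n E F)" for i j
  have f: "f i j + f j i = 2 * (if (i, j) \<in> A then root_form (i, j) H else - root_form (i, j) H) * v A"
    if ij: "(i, j) \<in> q_pos_roots c" for i j
  proof -
    note D = q_pos_rootsD[OF ij, folded n_def]
    have n0: "(of_nat n :: complex) \<noteq> 0" using D by auto
    have "clifford c (unit_matrix n (j, i)) v = (\<lambda>A. 4 * of_nat n * contract (i, j) v A)"
      by (rule ext, subst clifford_neg[OF ij, where z = 1]) (auto simp: unit_matrix_def n_def)
    moreover have "clifford c (H * unit_matrix n (i, j) - unit_matrix n (i, j) * H) w A
        = root_form (i, j) H * wedge (i, j) w A" for w
      by (rule clifford_pos[OF ij]) (use D commutator_unit[OF H, folded n_def] in \<open>auto simp: n_def\<close>)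
    ultimately have 1: "f i j = 2 * (if (i, j) \<in> A then root_form (i, j) H * v A else 0)"
      unfolding f_def Let_def using D n0 by (auto simp: killing_unit wedge_contract)
    have "clifford c (unit_matrix n (i, j)) v = (\<lambda>A. 1 * wedge (i, j) v A)"
      by (rule ext, subst clifford_pos[OF ij, where z = 1]) (auto simp: unit_matrix_def n_def)
    moreover have "clifford c (H * unit_matrix n (j, i) - unit_matrix n (j, i) * H) w A
        = 4 * of_nat n * root_form (j, i) H * contract (i, j) w A" for w
      unfolding n_def
      by (rule clifford_neg[OF ij]) (use D commutator_unit[OF H, folded n_def] in \<open>auto simp: n_def\<close>)
    ultimately have 2: "f j i = 2 * (if (i, j) \<in> A then 0 else root_form (j, i) H * v A)"
      unfolding f_def Let_def using D n0 by (auto simp: killing_unit contract_wedge[where a = 1, simplified])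
    show ?thesis unfolding 1 2 by (auto simp: root_form_def algebra_simps)
  qed
  have "spin_action c H v A = 1 / 4 * (\<Sum>(i, j)\<in>q_pos_roots c. f i j + f j i)"
    unfolding spin_action_def sum_q_pairs[symmetric] f_def n_def by (simp add: Let_def)
  also have "(\<Sum>(i, j)\<in>q_pos_roots c. f i j + f j i)
      = (\<Sum>\<alpha>\<in>q_pos_roots c. 2 * (if \<alpha> \<in> A then root_form \<alpha> H else - root_form \<alpha> H) * v A)"
    by (intro sum.cong) (auto simp: f)
  also have "\<dots> = 2 * v A * (\<Sum>\<alpha>\<in>q_pos_roots c. if \<alpha> \<in> A then root_form \<alpha> H else - root_form \<alpha> H)"
    by (simp add: sum_distrib_left mult_ac)
  also have "(\<Sum>\<alpha>\<in>q_pos_roots c. if \<alpha> \<in> A then root_form \<alpha> H else - root_form \<alpha> H)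
      = (\<Sum>\<alpha>\<in>A. root_form \<alpha> H) - (\<Sum>\<alpha>\<in>q_pos_roots c - A. root_form \<alpha> H)"
    using A finite_q_pos_roots[of c]
    by (simp add: sum.If_cases sum_negf Int_absorb1 Diff_eq)
  also have "\<dots> = 2 * spin_weight c (q_pos_roots c - A) H"
    using A by (simp add: spin_weight_def double_diff)
  finally show ?thesis by simp
qed

lemma sum_spinor_apply: "(\<Sum>x\<in>S. f x) A = (\<Sum>x\<in>S. (f x :: spinor) A)"
  by (induction S rule: infinite_finite_induct) auto

lemma dim_supported:
  assumes "finite T"
  shows "spinors.dim {v. \<forall>A. v A \<noteq> 0 \<longrightarrow> A \<in> T} = card T"
proof -
  define e :: "(nat \<times> nat) set \<Rightarrow> spinor" where "e A = (\<lambda>B. if B = A then 1 else 0)" for A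
  have inj: "inj_on e T"
    by (rule inj_onI) (metis e_def zero_neq_one)
  have ind: "spinors.independent (e ` T)"
  proof (subst spinors.independent_explicit_finite_subsets, intro allI impI)
    fix S u
    assume S: "S \<subseteq> e ` T" "finite S" and eq: "(\<Sum>v\<in>S. (\<lambda>A. u v * v A)) = 0"
    show "\<forall>v\<in>S. u v = 0"
    proof
      fix v assume v: "v \<in> S"
      then obtain A where A: "A \<in> T" "v = e A" using S by auto
      have "0 = (\<Sum>w\<in>S. u w * w A)" using fun_cong[OF eq, of A]
        by (simp add: sum_spinor_apply)
      also have "\<dots> = (\<Sum>w\<in>S. if w = v then u w else 0)"
      proof (intro sum.cong refl)
        fix w assume "w \<in> S"
        then obtain B where B: "B \<in> T" "w = e B" using S by auto
        have "w = v \<longleftrightarrow> B = A" using A B inj by (auto simp: inj_on_eq_iff)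
        moreover have "w A = (if B = A then 1 else 0)" using B by (simp add: e_def)
        ultimately show "u w * w A = (if w = v then u w else 0)" by simp
      qed
      also have "\<dots> = u v" using S v by simp
      finally show "u v = 0" by simp
    qed
  qed
  have sub: "e ` T \<subseteq> {v. \<forall>A. v A \<noteq> 0 \<longrightarrow> A \<in> T}" by (auto simp: e_def split: if_splits)
  have span: "{v. \<forall>A. v A \<noteq> 0 \<longrightarrow> A \<in> T} \<subseteq> spinors.span (e ` T)"
  proof
    fix v assume v: "v \<in> {v :: spinor. \<forall>A. v A \<noteq> 0 \<longrightarrow> A \<in> T}"
    have "v = (\<Sum>A\<in>T. (\<lambda>B. v A * e A B))"
    proof
      fix B
      have "(\<Sum>A\<in>T. (\<lambda>B. v A * e A B)) B = (\<Sum>A\<in>T. v A * e A B)"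
        by (rule sum_spinor_apply)
      also have "\<dots> = (\<Sum>A\<in>T. if A = B then v B else 0)"
        by (intro sum.cong) (auto simp: e_def)
      also have "\<dots> = v B" using assms v by auto
      finally show "v B = (\<Sum>A\<in>T. (\<lambda>B. v A * e A B)) B" by simp
    qed
    also have "\<dots> \<in> spinors.span (e ` T)"
      by (intro spinors.span_sum spinors.span_scale spinors.span_base imageI)
    finally show "v \<in> spinors.span (e ` T)" .
  qed
  show ?thesis
    using spinors.dim_unique[OF sub span ind] card_image[OF inj] by simp
qed

lemma mult_S_eq_card:
  "mult_S c \<mu> =
    card {A. A \<subseteq> q_pos_roots c \<and> (\<forall>H\<in>cartan (sum_list c). spin_weight c A H = \<mu> H)}"
proof -
  let ?R = "q_pos_roots c"
  let ?T = "{A. A \<subseteq> ?R \<and> (\<forall>H\<in>cartan (sum_list c). spin_weight c (?R - A) H = \<mu> H)}"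
  have out: "spin_action c H v A = 0" if v: "v \<in> spin_module c" and A: "\<not> A \<subseteq> ?R" for H v A
  proof -
    have cl: "clifford c X w \<in> spin_module c" if w: "w \<in> spin_module c" for X w
    proof -
      have "clifford c X w B = 0" if B: "\<not> B \<subseteq> ?R" for B
      proof -
        have "wedge \<alpha> w B = 0 \<and> contract \<alpha> w B = 0" if "\<alpha> \<in> ?R" for \<alpha>
        proof -
          have "\<not> B - {\<alpha>} \<subseteq> ?R" "\<not> insert \<alpha> B \<subseteq> ?R" using that B by auto
          thus ?thesis using w unfolding wedge_def contract_def spin_module_def by auto
        qed
        thus ?thesis unfolding clifford_def by (intro sum.neutral) auto
      qed
      thus ?thesis unfolding spin_module_def by blast
    qed
    have "clifford c X (clifford c Y v) A = 0" for X Y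
      using cl[OF cl[OF v]] A unfolding spin_module_def by blast
    thus ?thesis unfolding spin_action_def by (simp add: Let_def)
  qed
  have "weight_space c \<mu> = {v. \<forall>A. v A \<noteq> 0 \<longrightarrow> A \<in> ?T}"
  proof (intro Set.set_eqI iffI)
    fix v assume v: "v \<in> weight_space c \<mu>"
    have "A \<in> ?T" if "v A \<noteq> 0" for A
    proof -
      have A: "A \<subseteq> ?R" using v that by (auto simp: weight_space_def spin_module_def)
      have "spin_weight c (?R - A) H = \<mu> H" if "H \<in> cartan (sum_list c)" for H
      proof -
        have "spin_action c H v A = \<mu> H * v A" using v that by (auto simp: weight_space_def)
        thus ?thesis using spin_action_cartan[OF that A, of v] \<open>v A \<noteq> 0\<close> by simp
      qed
      thus ?thesis using A by auto
    qed
    thus "v \<in> {v. \<forall>A. v A \<noteq> 0 \<longrightarrow> A \<in> ?T}" by auto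
  next
    fix v assume v: "v \<in> {v :: spinor. \<forall>A. v A \<noteq> 0 \<longrightarrow> A \<in> ?T}"
    hence S: "v \<in> spin_module c" by (auto simp: spin_module_def)
    have "spin_action c H v A = \<mu> H * v A" if H: "H \<in> cartan (sum_list c)" for H A
    proof (cases "A \<subseteq> ?R")
      case True
      thus ?thesis using spin_action_cartan[OF H True, of v] v H by (cases "v A = 0") auto
    next
      case False
      thus ?thesis using out[OF S False, of H] S by (auto simp: spin_module_def)
    qed
    thus "v \<in> weight_space c \<mu>" using S by (auto simp: weight_space_def)
  qed
  moreover have "finite ?T" using finite_q_pos_roots[of c] by (auto intro: finite_subset[of _ "Pow ?R"])
  ultimately have "mult_S c \<mu> = card ?T" unfolding mult_S_def by (simp only: dim_supported)
  also have "\<dots> = card {A. A \<subseteq> ?R \<and> (\<forall>H\<in>cartan (sum_list c). spin_weight c A H = \<mu> H)}"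
    by (rule bij_betw_same_card[of "\<lambda>A. ?R - A"], rule bij_betw_byWitness[where f' = "\<lambda>A. ?R - A"])
      (auto simp: double_diff)
  finally show ?thesis .
qed

end

theory Submission
  imports Defs
begin

text \<open>
  Split \<open>\<Phi>\<^sup>+(\<qq>)\<close> into the roots \<open>\<epsilon>\<^sub>1 - \<epsilon>\<^sub>j\<close> with \<open>j > c\<^sub>1\<close> and the remaining ones, which are the positive
  roots of \<open>\<qq>\<close> for \<open>(c\<^sub>1 - 1, c\<^sub>2, \<dots>, c\<^sub>k)\<close> after an index shift.  A set \<open>A\<close> of roots is thus a pair of a
  set \<open>A'\<close> of shifted roots and the set \<open>J\<close> of those \<open>j > c\<^sub>1\<close> for which \<open>\<epsilon>\<^sub>1 - \<epsilon>\<^sub>j\<close> is not in \<open>A\<close>.  The first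
  coordinate of the weight of \<open>A\<close> is \<open>#J - (n - c\<^sub>1) / 2\<close>, so it fixes the size of \<open>J\<close>; the roots
  \<open>\<epsilon>\<^sub>1 - \<epsilon>\<^sub>j\<close> contribute \<open>1/2 - 1\<^sub>J(j)\<close> to the coordinate \<open>j\<close>.
\<close>

section \<open>Weights of the spin module in coordinates\<close>

definition root_coord :: "nat \<times> nat \<Rightarrow> nat \<Rightarrow> real" where
  "root_coord \<alpha> i = of_bool (i = fst \<alpha>) - of_bool (i = snd \<alpha>)"

text \<open>The coefficient of \<epsilon>_i in the weight \<mu>(A), obtained by expanding every
  root. Real values make a sum of squares usable for comparing weights.\<close>

definition spin_coord :: "nat list \<Rightarrow> (nat \<times> nat) set \<Rightarrow> nat \<Rightarrow> real" where
  "spin_coord c A i = (\<Sum>\<alpha>\<in>q_pos_roots c. (if \<alpha> \<in> A then - 1 else 1) * root_coord \<alpha> i) / 2"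

lemma spin_weight_eq:
  assumes "A \<subseteq> q_pos_roots c"
  shows "spin_weight c A H = (\<Sum>i<sum_list c. complex_of_real (spin_coord c A i) * eps i H)"
proof -
  let ?n = "sum_list c" and ?s = "\<lambda>\<alpha>. if \<alpha> \<in> A then - 1 else 1 :: real"
  have eps: "(\<Sum>i<?n. complex_of_real (of_bool (i = a)) * eps i H) = eps a H" if "a < ?n" for a
  proof -
    have "(\<Sum>i<?n. complex_of_real (of_bool (i = a)) * eps i H) = (\<Sum>i<?n. if i = a then eps i H else 0)"
      by (intro sum.cong) auto
    thus ?thesis using that by simp
  qed
  have root: "root_form \<alpha> H = (\<Sum>i<?n. complex_of_real (root_coord \<alpha> i) * eps i H)"
    if "\<alpha> \<in> q_pos_roots c" for \<alpha>
  proof -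
    have "fst \<alpha> < ?n" "snd \<alpha> < ?n"
      using that q_pos_rootsD[of "fst \<alpha>" "snd \<alpha>" c] by auto
    thus ?thesis
      by (simp only: root_form_def root_coord_def left_diff_distrib sum_subtractf of_real_diff eps)
  qed
  have "(\<Sum>\<alpha>\<in>q_pos_roots c. complex_of_real (?s \<alpha>) * root_form \<alpha> H)
      = (\<Sum>\<alpha>\<in>q_pos_roots c. if \<alpha> \<in> A then - root_form \<alpha> H else root_form \<alpha> H)"
    by (intro sum.cong) auto
  hence "spin_weight c A H = 1 / 2 * (\<Sum>\<alpha>\<in>q_pos_roots c. complex_of_real (?s \<alpha>) * root_form \<alpha> H)"
    using assms finite_q_pos_roots[of c]
    by (simp add: spin_weight_def sum.If_cases sum_negf Int_absorb1 Diff_eq)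
  also have "(\<Sum>\<alpha>\<in>q_pos_roots c. complex_of_real (?s \<alpha>) * root_form \<alpha> H)
      = (\<Sum>\<alpha>\<in>q_pos_roots c. \<Sum>i<?n. complex_of_real (?s \<alpha> * root_coord \<alpha> i) * eps i H)"
    by (intro sum.cong) (simp_all add: root sum_distrib_left mult.assoc)
  also have "\<dots> = (\<Sum>i<?n. \<Sum>\<alpha>\<in>q_pos_roots c. complex_of_real (?s \<alpha> * root_coord \<alpha> i) * eps i H)"
    by (rule sum.swap)
  also have "1 / 2 * \<dots> = (\<Sum>i<?n. complex_of_real (spin_coord c A i) * eps i H)"
    unfolding sum_distrib_left
    by (intro sum.cong) (simp_all add: spin_coord_def sum_distrib_right sum_divide_distrib)
  finally show ?thesis .
qed

text \<open>Each root has coordinate sum 0. This normalises the coefficients of a weight.\<close>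

lemma sum_spin_coord: "(\<Sum>i<sum_list c. spin_coord c A i) = 0"
proof -
  let ?n = "sum_list c"
  have "(\<Sum>i<?n. root_coord \<alpha> i) = 0" if "\<alpha> \<in> q_pos_roots c" for \<alpha>
    using that q_pos_rootsD[of "fst \<alpha>" "snd \<alpha>" c]
    by (simp add: root_coord_def sum_subtractf of_bool_def)
  hence "(\<Sum>\<alpha>\<in>q_pos_roots c. \<Sum>i<?n. (if \<alpha> \<in> A then - 1 else 1) * root_coord \<alpha> i) = 0"
    by (simp flip: sum_distrib_left)
  thus ?thesis
    unfolding spin_coord_def by (subst (asm) sum.swap) (simp flip: sum_divide_distrib)
qed

text \<open>The \<epsilon>_i add up to 0 on traceless matrices, so a functional fixes its
  coefficients only up to a common constant; the hypothesis of equal sums excludes such a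
  shift.\<close>

lemma cartan_functionals_eq_iff:
  fixes f g :: "nat \<Rightarrow> real"
  assumes "(\<Sum>i<n. f i) = (\<Sum>i<n. g i)"
  shows "(\<forall>H\<in>cartan n. (\<Sum>i<n. complex_of_real (f i) * eps i H) = (\<Sum>i<n. complex_of_real (g i) * eps i H))
    \<longleftrightarrow> (\<forall>i<n. f i = g i)"
proof
  assume L: "\<forall>H\<in>cartan n. (\<Sum>i<n. complex_of_real (f i) * eps i H) = (\<Sum>i<n. complex_of_real (g i) * eps i H)"
  \<comment> \<open>Test on \<open>diag (f - g)\<close>, which is traceless and on which the difference is \<open>\<Sum>(f i - g i)\<^sup>2\<close>.\<close>
  define H where "H = mat n n (\<lambda>(i, j). if i = j then complex_of_real (f i - g i) else 0)"
  have "(\<Sum>i<n. H $$ (i, i)) = complex_of_real (\<Sum>i<n. f i - g i)"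
    by (simp add: H_def)
  hence "H \<in> cartan n"
    using assms by (simp add: cartan_def diagonal_mat_def sum_subtractf H_def)
  hence "(\<Sum>i<n. complex_of_real (f i) * eps i H) = (\<Sum>i<n. complex_of_real (g i) * eps i H)"
    using L by blast
  hence "0 = (\<Sum>i<n. complex_of_real (f i - g i) * eps i H)"
    by (simp add: left_diff_distrib sum_subtractf)
  also have "\<dots> = complex_of_real (\<Sum>i<n. (f i - g i)\<^sup>2)"
    by (simp add: eps_def H_def power2_eq_square)
  finally have "(\<Sum>i<n. (f i - g i)\<^sup>2) = 0"
    by (metis of_real_eq_0_iff)
  thus "\<forall>i<n. f i = g i"
    by (simp add: sum_nonneg_eq_0_iff)
qed simp

text \<open>This removes the matrices: what remains is to count sets of roots with prescribed
  coordinates.\<close>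

lemma spin_mult_eq_card:
  assumes "length bs = sum_list c" and "(\<Sum>i<sum_list c. bs ! i) = 0"
  shows "spin_mult c bs =
    card {A. A \<subseteq> q_pos_roots c \<and> (\<forall>i<sum_list c. spin_coord c A i = bs ! i)}"
proof -
  have "(\<forall>H\<in>cartan (sum_list c). spin_weight c A H = (\<Sum>i<length bs. complex_of_real (bs ! i) * eps i H))
      \<longleftrightarrow> (\<forall>i<sum_list c. spin_coord c A i = bs ! i)" if "A \<subseteq> q_pos_roots c" for A
    using assms cartan_functionals_eq_iff[of "spin_coord c A" "sum_list c" "(!) bs"]
    by (simp add: spin_weight_eq[OF that] sum_spin_coord)
  thus ?thesis
    unfolding spin_mult_def mult_S_eq_card
    by (intro arg_cong[where f = card] Collect_cong conj_cong refl) auto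
qed

section \<open>Splitting the roots at the first index\<close>

definition decr_hd :: "nat list \<Rightarrow> nat list" where
  "decr_hd c = filter (\<lambda>x. x \<noteq> 0) ((hd c - 1) # tl c)"

lemma decr_hd_Cons:
  assumes "\<forall>x\<in>set c. x \<ge> 1"
  shows "decr_hd (m # c) = (if m \<le> 1 then c else (m - 1) # c)"
  using assms by (auto simp: decr_hd_def intro!: filter_True)

abbreviation shift_pair :: "nat \<times> nat \<Rightarrow> nat \<times> nat" where
  "shift_pair \<equiv> map_prod Suc Suc"

lemma inj_shift_pair: "inj shift_pair"
  by (intro prod.inj_map inj_Suc)

text \<open>Index 0 lies in the first block, so its partners are the indices from \<open>m\<close>
  on. Deleting it shortens that block by one and shifts the other indices. If \<open>m = 1\<close>
  the block vanishes and all block labels drop by one, which does not affect whether two labels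
  differ.\<close>

lemma q_pos_roots_Cons:
  assumes "\<forall>x\<in>set c. x \<ge> 1" and "m \<ge> 1"
  shows "q_pos_roots (m # c) =
    Pair 0 ` {m..<m + sum_list c} \<union> shift_pair ` q_pos_roots (decr_hd (m # c))"
proof (rule Set.set_eqI)
  fix \<alpha> :: "nat \<times> nat"
  obtain i j where \<alpha>: "\<alpha> = (i, j)" by (cases \<alpha>)
  have *: "(Suc k, Suc l) \<in> shift_pair ` B \<longleftrightarrow> (k, l) \<in> B" for k l B by force
  have **: "(0, l) \<notin> shift_pair ` B" "(l, 0) \<notin> shift_pair ` B" for l B by auto
  show "\<alpha> \<in> q_pos_roots (m # c) \<longleftrightarrow>
      \<alpha> \<in> Pair 0 ` {m..<m + sum_list c} \<union> shift_pair ` q_pos_roots (decr_hd (m # c))"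
  proof (cases i)
    case 0
    thus ?thesis using assms(2) by (auto simp: \<alpha> ** q_pos_roots_def q_pairs_def)
  next
    case (Suc k)
    show ?thesis
    proof (cases j)
      case 0
      thus ?thesis using Suc by (auto simp: \<alpha> q_pos_roots_def)
    next
      case (Suc l)
      with \<open>i = Suc k\<close> show ?thesis using assms(2)
        by (auto simp: \<alpha> * decr_hd_Cons[OF assms(1)] q_pos_roots_def q_pairs_def Suc_diff_le
            split: if_splits)
    qed
  qed
qed

text \<open>\<open>J\<close> is numbered from 1 as in the theorem, matrix indices from 0, hence
  \<open>Suc j\<close>. The roots in the glued set are those that \<open>J\<close> leaves out, since
  the roots outside the set enter the weight with a plus sign.\<close>

definition glue :: "nat \<Rightarrow> nat \<Rightarrow> nat set \<Rightarrow> (nat \<times> nat) set \<Rightarrow> (nat \<times> nat) set" where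
  "glue m n J A = Pair 0 ` {j \<in> {m..<n}. Suc j \<notin> J} \<union> shift_pair ` A"

lemma mem_glue:
  "(0, j) \<in> glue m n J A \<longleftrightarrow> j \<in> {m..<n} \<and> Suc j \<notin> J"
  "shift_pair \<alpha> \<in> glue m n J A \<longleftrightarrow> \<alpha> \<in> A"
  by (auto simp: glue_def inj_image_mem_iff[OF inj_shift_pair] map_prod_def split: prod.splits)

text \<open>The weight is a signed sum over two disjoint families. A shifted root vanishes at
  coordinate 0 and has at \<open>Suc k\<close> what the original root has at
  \<open>k\<close>.\<close>

lemma spin_coord_glue:
  assumes c: "\<forall>x\<in>set c. x \<ge> 1" and m: "m \<ge> 1" and n: "n = m + sum_list c"
  shows "spin_coord (m # c) (glue m n J A) i =
    (\<Sum>j\<in>{m..<n}. (if Suc j \<in> J then 1 else - 1) * root_coord (0, j) i) / 2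
    + (case i of 0 \<Rightarrow> 0 | Suc k \<Rightarrow> spin_coord (decr_hd (m # c)) A k)"
proof -
  let ?R = "q_pos_roots (decr_hd (m # c))" and ?A = "glue m n J A"
  let ?f = "\<lambda>\<alpha>. (if \<alpha> \<in> ?A then - 1 else 1) * root_coord \<alpha> i"
  have "(\<Sum>\<alpha>\<in>q_pos_roots (m # c). ?f \<alpha>) = (\<Sum>\<alpha>\<in>Pair 0 ` {m..<n}. ?f \<alpha>) + (\<Sum>\<alpha>\<in>shift_pair ` ?R. ?f \<alpha>)"
    unfolding q_pos_roots_Cons[OF c m] n
    by (rule sum.union_disjoint) (auto simp: finite_q_pos_roots)
  also have "(\<Sum>\<alpha>\<in>Pair 0 ` {m..<n}. ?f \<alpha>) = (\<Sum>j\<in>{m..<n}. (if Suc j \<in> J then 1 else - 1) * root_coord (0, j) i)"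
    by (subst sum.reindex) (auto simp: inj_on_def mem_glue intro!: sum.cong)
  also have "(\<Sum>\<alpha>\<in>shift_pair ` ?R. ?f \<alpha>)
      = (\<Sum>\<alpha>\<in>?R. (if \<alpha> \<in> A then - 1 else 1) * root_coord (shift_pair \<alpha>) i)"
    by (subst sum.reindex) (auto simp: mem_glue simp del: map_prod_simp intro: inj_on_subset[OF inj_shift_pair])
  also have "\<dots> = 2 * (case i of 0 \<Rightarrow> 0 | Suc k \<Rightarrow> spin_coord (decr_hd (m # c)) A k)"
    by (cases i) (auto simp: spin_coord_def root_coord_def)
  finally show ?thesis
    unfolding spin_coord_def[of "m # c"] by (simp add: add_divide_distrib)
qed

lemma sum_indicator_subset:
  assumes "finite I" and "J \<subseteq> I"
  shows "(\<Sum>i\<in>I. indicator J i :: real) = real (card J)"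
  using assms by (simp add: indicator_def of_bool_def sum.If_cases Int_absorb1)

lemma spin_coord_glue_0:
  assumes "\<forall>x\<in>set c. x \<ge> 1" and "m \<ge> 1" and "n = m + sum_list c" and J: "J \<subseteq> {m + 1..n}"
  shows "spin_coord (m # c) (glue m n J A) 0 = real (card J) - (real n - real m) / 2"
proof -
  \<comment> \<open>Here \<open>j \<ge> m \<ge> 1\<close>, so \<open>root_coord (0, j) 0\<close> is
    1 and only the sign remains.\<close>
  have "(\<Sum>j\<in>{m..<n}. (if Suc j \<in> J then 1 else - 1) * root_coord (0, j) 0)
      = (\<Sum>j\<in>{m..<n}. 2 * indicator J (Suc j) - 1)"
    using assms(2) by (intro sum.cong) (auto simp: root_coord_def)
  also have "\<dots> = 2 * (\<Sum>j\<in>{m..<n}. indicator J (Suc j)) - (real n - real m)"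
    using assms(3) by (simp add: sum_subtractf sum_distrib_left)
  also have "(\<Sum>j\<in>{m..<n}. indicator J (Suc j)) = (\<Sum>j\<in>{m + 1..n}. indicator J j :: real)"
    using sum.shift_bounds_Suc_ivl[of "indicator J :: nat \<Rightarrow> real" m n]
    by (simp add: atLeastLessThanSuc_atLeastAtMost)
  also have "\<dots> = real (card J)"
    using J by (simp add: sum_indicator_subset)
  finally show ?thesis
    by (simp add: spin_coord_glue[OF assms(1-3)] field_simps)
qed

text \<open>Of the roots \<open>(0, j)\<close> only the one with \<open>j = Suc k\<close> reaches
  this coordinate, with coefficient -1. Counted from 1, this coordinate has number
  \<open>k + 2\<close>.\<close>

lemma spin_coord_glue_Suc:
  assumes "\<forall>x\<in>set c. x \<ge> 1" and "m \<ge> 1" and "n = m + sum_list c" and "Suc k < n"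
  shows "spin_coord (m # c) (glue m n J A) (Suc k) = spin_coord (decr_hd (m # c)) A k
    + (if m \<le> Suc k then 1 / 2 - indicator J (k + 2) else 0)"
proof -
  have "(\<Sum>j\<in>{m..<n}. (if Suc j \<in> J then 1 else - 1) * root_coord (0, j) (Suc k))
      = (\<Sum>j\<in>{m..<n}. if Suc k = j then (if Suc j \<in> J then - 1 else 1) else 0)"
    by (intro sum.cong) (auto simp: root_coord_def)
  thus ?thesis
    using assms(4) by (simp add: spin_coord_glue[OF assms(1-3)])
qed

lemma bij_betw_glue:
  assumes c: "\<forall>x\<in>set c. x \<ge> 1" and m: "m \<ge> 1" and n: "n = m + sum_list c"
  shows "bij_betw (\<lambda>(J, A). glue m n J A) (Pow {m + 1..n} \<times> Pow (q_pos_roots (decr_hd (m # c))))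
    (Pow (q_pos_roots (m # c)))"
\<comment> \<open>The inverse reads \<open>J\<close> off the missing roots \<open>(0, j - 1)\<close>
  and undoes the shift on the other roots.\<close>
proof (rule bij_betw_byWitness[where f' = "\<lambda>A. ({j \<in> {m + 1..n}. (0, j - 1) \<notin> A}, shift_pair -` A)"])
  let ?R = "q_pos_roots (decr_hd (m # c))"
  note R = q_pos_roots_Cons[OF c m, folded n]
  show "\<forall>x\<in>Pow {m + 1..n} \<times> Pow ?R.
      (\<lambda>A. ({j \<in> {m + 1..n}. (0, j - 1) \<notin> A}, shift_pair -` A)) (case x of (J, A) \<Rightarrow> glue m n J A) = x"
  proof (clarsimp simp del: One_nat_def, intro conjI)
    fix J A assume J: "J \<subseteq> {m + 1..n}"
    show "{j. m + 1 \<le> j \<and> j \<le> n \<and> (0, j - 1) \<notin> glue m n J A} = J"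
      using J m by (auto simp: mem_glue)
    show "shift_pair -` glue m n J A = A"
      by (rule Set.set_eqI) (simp only: vimage_eq mem_glue)
  qed
  show "\<forall>A\<in>Pow (q_pos_roots (m # c)). (\<lambda>(J, A). glue m n J A)
      ({j \<in> {m + 1..n}. (0, j - 1) \<notin> A}, shift_pair -` A) = A"
  proof
    fix A assume A: "A \<in> Pow (q_pos_roots (m # c))"
    have "glue m n {j \<in> {m + 1..n}. (0, j - 1) \<notin> A} (shift_pair -` A)
        = A \<inter> (Pair 0 ` {m..<n} \<union> range shift_pair)"
      by (auto simp: glue_def)
    also have "\<dots> = A" using A unfolding R by auto
    finally show "(\<lambda>(J, A). glue m n J A) ({j \<in> {m + 1..n}. (0, j - 1) \<notin> A}, shift_pair -` A) = A"
      by simp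
  qed
  show "(\<lambda>(J, A). glue m n J A) ` (Pow {m + 1..n} \<times> Pow ?R) \<subseteq> Pow (q_pos_roots (m # c))"
    unfolding R by (auto simp: glue_def)
  show "(\<lambda>A. ({j \<in> {m + 1..n}. (0, j - 1) \<notin> A}, shift_pair -` A)) ` Pow (q_pos_roots (m # c))
      \<subseteq> Pow {m + 1..n} \<times> Pow ?R"
    unfolding R by auto
qed

section \<open>The recursion for multiplicities\<close>

theorem theoremA:
  fixes n :: nat and c :: "nat list" and b :: "nat \<Rightarrow> real"
  assumes "n \<ge> 1"
    and "sorted c"
    and "\<forall>x\<in>set c. x \<ge> 1"
    and "sum_list c = n"
    and "\<forall>i\<in>{1..n}. \<exists>z::int. b i = real_of_int z / 2"
    and "(\<Sum>i=1..n. b i) = 0"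
  shows "spin_mult c (map b [1..<n + 1]) =
    (\<Sum>J\<in>subsets_of_size (b 1 + (real n - real (hd c)) / 2) {hd c + 1..n}.
      spin_mult (filter (\<lambda>x. x \<noteq> 0) ((hd c - 1) # tl c))
        (map b [2..<hd c + 1] @ map (\<lambda>i. b i + indicator J i - 1 / 2) [hd c + 1..<n + 1]))"
proof -
  obtain m d where c: "c = m # d"
    using assms(1,4) by (cases c) auto
  have d: "\<forall>x\<in>set d. x \<ge> 1" and m: "m \<ge> 1" and n: "n = m + sum_list d"
    using assms(3,4) c by auto
  define c' where "c' = decr_hd (m # d)"
  define Js where "Js = subsets_of_size (b 1 + (real n - real m) / 2) {m + 1..n}"
  define bs where "bs J = map b [2..<m + 1] @ map (\<lambda>i. b i + indicator J i - 1 / 2) [m + 1..<n + 1]" for J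
  define S where "S J = {A. A \<subseteq> q_pos_roots c' \<and> (\<forall>k<n - 1. spin_coord c' A k = bs J ! k)}" for J
  define P where "P A \<longleftrightarrow> (\<forall>i<n. spin_coord c A i = map b [1..<n + 1] ! i)" for A
  have n': "sum_list c' = n - 1"
    using m n by (auto simp: c'_def decr_hd_Cons[OF d])
  have Js: "J \<in> Js \<longleftrightarrow> J \<subseteq> {m + 1..n} \<and> real (card J) = b 1 + (real n - real m) / 2" for J
    by (auto simp: Js_def subsets_of_size_def intro: finite_subset[OF _ finite_atLeastAtMost])
  \<comment> \<open>One formula for both segments of the list. The subtracted term is what the roots
    \<open>(0, j)\<close> add to coordinate \<open>Suc k\<close>, so moving it across turns the
    condition for \<open>c\<close> into the one for \<open>c'\<close>.\<close>
  have nth: "bs J ! k = b (k + 2) - (if m \<le> Suc k then 1 / 2 - indicator J (k + 2) else 0)"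
    if "Suc k < n" for J k
    using that m by (auto simp: bs_def nth_append nth_upt simp del: upt_Suc)
  \<comment> \<open>Coordinate 0 tests only the size of \<open>J\<close>; given \<open>J\<close>,
    the other coordinates test \<open>A\<close>.\<close>
  have P: "P (glue m n J A) \<longleftrightarrow> J \<in> Js \<and> A \<in> S J"
    if J: "J \<subseteq> {m + 1..n}" and A: "A \<subseteq> q_pos_roots c'" for J A
  proof -
    have "P (glue m n J A) \<longleftrightarrow> spin_coord c (glue m n J A) 0 = b 1
        \<and> (\<forall>k<n - 1. spin_coord c (glue m n J A) (Suc k) = b (k + 2))"
      using assms(1) by (cases n) (simp_all add: P_def All_less_Suc2 del: upt_Suc)
    also have "spin_coord c (glue m n J A) 0 = b 1 \<longleftrightarrow> J \<in> Js"
      unfolding c spin_coord_glue_0[OF d m n J] using J by (auto simp: Js)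
    also have "(\<forall>k<n - 1. spin_coord c (glue m n J A) (Suc k) = b (k + 2)) \<longleftrightarrow> A \<in> S J"
      using A by (auto simp: c c'_def S_def spin_coord_glue_Suc[OF d m n] nth)
    finally show ?thesis .
  qed
  have "(\<Sum>i<n. map b [1..<n + 1] ! i) = (\<Sum>i=1..n. b i)"
    by (rule sum.reindex_bij_witness[where i = "\<lambda>i. i - 1" and j = Suc]) (auto simp del: upt_Suc)
  hence "spin_mult c (map b [1..<n + 1]) =
      card {A \<in> Pow (q_pos_roots c). P A}"
    using spin_mult_eq_card[of "map b [1..<n + 1]" c] assms(4,6) by (simp add: P_def del: upt_Suc)
  also have "\<dots> = card (Sigma Js S)"
  proof (rule bij_betw_same_card[symmetric])
    have "bij_betw (\<lambda>(J, A). glue m n J A)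
        {x \<in> Pow {m + 1..n} \<times> Pow (q_pos_roots c'). x \<in> Sigma Js S} {A \<in> Pow (q_pos_roots c). P A}"
      using bij_betw_glue[OF d m n, folded c'_def c] by (rule bij_betw_Collect) (auto simp: P)
    moreover have "{x \<in> Pow {m + 1..n} \<times> Pow (q_pos_roots c'). x \<in> Sigma Js S} = Sigma Js S"
      unfolding S_def using Js by blast
    ultimately show "bij_betw (\<lambda>(J, A). glue m n J A) (Sigma Js S) {A \<in> Pow (q_pos_roots c). P A}"
      by simp
  qed
  also have "\<dots> = (\<Sum>J\<in>Js. card (S J))"
  proof (rule card_SigmaI)
    show "finite Js"
      by (rule finite_subset[of _ "Pow {m + 1..n}"]) (use Js in blast, simp)
    show "\<forall>J\<in>Js. finite (S J)"
      using finite_subset[of _ "Pow (q_pos_roots c')"] finite_q_pos_roots[of c'] by (auto simp: S_def)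
  qed
  also have "\<dots> = (\<Sum>J\<in>Js. spin_mult c' (bs J))"
  proof (rule sum.cong[OF refl])
    fix J assume J: "J \<in> Js"
    \<comment> \<open>Counting for \<open>c'\<close> requires coordinate sum 0. Dropping
      \<open>b 1\<close> is balanced by the total change of the later entries,
      \<open>card J - (n - m) / 2\<close>, which equals \<open>b 1\<close> by the size condition on
      \<open>J\<close>.\<close>
    have "(\<Sum>k<n - 1. bs J ! k) = 0"
    proof -
      have *: "(\<Sum>k<n - 1. bs J ! k) = sum_list (bs J)"
        using m n by (simp add: sum_list_sum_nth bs_def atLeast0LessThan del: upt_Suc)
      have "sum_list (bs J) = (\<Sum>i\<in>{2..<m + 1}. b i) + (\<Sum>i\<in>{m + 1..<n + 1}. b i + indicator J i - 1 / 2)"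
        by (simp add: bs_def interv_sum_list_conv_sum_set_nat del: upt_Suc)
      also have "(\<Sum>i\<in>{m + 1..<n + 1}. b i + indicator J i - 1 / 2)
          = (\<Sum>i\<in>{m + 1..<n + 1}. b i) + (\<Sum>i\<in>{m + 1..n}. indicator J i) - (real n - real m) / 2"
        using n by (simp add: sum.distrib sum_subtractf atLeastLessThanSuc_atLeastAtMost)
      also have "(\<Sum>i\<in>{m + 1..n}. indicator J i :: real) = b 1 + (real n - real m) / 2"
        using J by (simp add: Js sum_indicator_subset)
      also have "(\<Sum>i\<in>{2..<m + 1}. b i) + ((\<Sum>i\<in>{m + 1..<n + 1}. b i)
          + (b 1 + (real n - real m) / 2) - (real n - real m) / 2) = b 1 + (\<Sum>i\<in>{2..<n + 1}. b i)"
        using m n sum.atLeastLessThan_concat[of 2 "m + 1" "n + 1" b] by simp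
      also have "\<dots> = 0"
        using assms(1,6) sum.atLeast_Suc_atMost[of 1 n b]
        by (simp add: atLeastLessThanSuc_atLeastAtMost numeral_2_eq_2)
      finally show ?thesis using * by simp
    qed
    moreover have "length (bs J) = n - 1"
      using m n by (simp add: bs_def del: upt_Suc)
    ultimately show "card (S J) = spin_mult c' (bs J)"
      using spin_mult_eq_card[of "bs J" c'] by (simp add: n' S_def)
  qed
  finally show ?thesis
    by (simp add: Js_def bs_def c'_def decr_hd_def c)
qed

end
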